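(* Let $(\mathbf{H},\varphi)$ be a linearized combinatorial Hopf monoid such that $\varphi$ is a balanced convex character, let $N$ be a finite set, $\mathbf{h}\in\mathbf{H}[N]$, and $\mathfrak{G}\subseteq\mathrm{Aut}(\mathbf{h})$. Then $\mathfrak{G}\subseteq\mathrm{Aut}(\Sigma_\varphi(\mathbf{h}))$ (for the action of $\mathfrak{G}$ on subsets of $N$), and $$\Psi_{\mathbf{H},\varphi}(\mathbf{h},\mathfrak{G},\mathbf{x})=F(\Sigma_\varphi(\mathbf{h}),\mathfrak{G},\mathbf{x}).$$
   Context: $\mathbb{N}=\{0,1,2,\dots\}$. A set species $\mathbf{H}$ assigns to each finite set $N$ a finite set $\mathbf{H}[N]$ and to each bijection $\sigma$ a bijection $\mathbf{H}[\sigma]$, functorially. A linearized Hopf monoid: a set species with $|\mathbf{H}[\emptyset]|=1$ and maps $\mu_{M,N}:\mathbf{H}[M]\times\mathbf{H}[N]\to\mathbf{H}[M\sqcup N]$ and $\Delta_{M,N}:\mathbf{H}[M\sqcup N]\to(\mathbf{H}[M]\times\mathbf{H}[N])\sqcup\{0\}$ (write $\Delta_{M,N}(\mathbf{h})=(\mathbf{h}|_M,\mathbf{h}/M)$ when nonzero) for disjoint finite $M,N$, whose linear extensions make the linearization a connected Hopf monoid in linear species. A linearized character: maps $\varphi_N:\mathbf{H}[N]\to\{0,1\}$ natural in bijections and multiplicative, $\varphi(x\cdot y)=\varphi(x)\varphi(y)$. It is balanced convex if for all $\mathbf{h}\in\mathbf{H}[N]$: $|N|=1\Rightarrow\varphi(\mathbf{h})=1$;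 if $|N|>1$ some nonempty $S\subsetneq N$ has $\Delta_{S,N\setminus S}(\mathbf{h})\ne0$; and if $\varphi(\mathbf{h})=1$ and $\Delta_{S,N\setminus S}(\mathbf{h})\ne0$ then $\varphi(\mathbf{h}|_S)=\varphi(\mathbf{h}/S)=1$. For a set composition $C=C_1|\cdots|C_k\models N$, $\Delta_C(\mathbf{h})$ is $\mathbf{h}$ if $k=1$, otherwise $0$ if $\Delta_{C_1,N\setminus C_1}(\mathbf{h})=0$, else $(\mathbf{h}|_{C_1},\Delta_{C_2|\cdots|C_k}(\mathbf{h}/C_1))$; $\varphi_C(\mathbf{h})=\prod\varphi(\mathbf{h}_i)$ if $\Delta_C(\mathbf{h})=(\mathbf{h}_1,\dots,\mathbf{h}_k)$, else $0$. For $f:N\to\mathbb{N}$ with values $i_1<\dots<i_k$, $C(f)=f^{-1}(i_1)|\cdots|f^{-1}(i_k)$, and $f$ is $\varphi$-proper iff $\varphi_{C(f)}(\mathbf{h})=1$. $\mathfrak{S}_N$ acts on $\mathbf{H}[N]$ via $\mathbf{H}[\mathfrak{g}]$; $\mathrm{Aut}(\mathbf{h})$ is the stabilizer; $\mathfrak{g}f=f\circ\mathfrak{g}^{-1}$. $\Psi_{\mathbf{H},\varphi}(\mathbf{h},\mathfrak{G},\mathbf{x};\mathfrak{g})=\sum_{f\ \varphi\text{-proper},\ \mathfrak{g}f=f}\prod_{v\in N}x_{f(v)}$. Coloring complex: vertices are the nonempty proper subsets of $N$ with $\kappa(S)=|S|$; faces are flags $F_\bullet=\{F_1\subset\cdots\subset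 F_k\}$ (strict chains of nonempty proper subsets, including the empty flag); the associated set composition is $C(F_\bullet)=F_1|F_2\setminus F_1|\cdots|F_k\setminus F_{k-1}|N\setminus F_k$ ($C=N$ for the empty flag); and $\Sigma_\varphi(\mathbf{h})=\{F_\bullet:\varphi_{C(F_\bullet)}(\mathbf{h})=1\}$. $\mathfrak{S}_N$ acts on flags by $\mathfrak{g}F_\bullet=\{\mathfrak{g}F_1\subset\cdots\subset\mathfrak{g}F_k\}$. An automorphism of a collection $\Phi$ of such flags is a bijection of vertices preserving $\kappa$ and mapping faces of $\Phi$ to faces of $\Phi$. For $S=\{s_1<\dots<s_k\}\subseteq[|N|-1]$, $\alpha(S)=(s_1,s_2-s_1,\dots,|N|-s_k)$, and $F(\Phi,\mathfrak{G},\mathbf{x};\mathfrak{g})=\sum_{F_\bullet\in\Phi:\ \mathfrak{g}F_\bullet=F_\bullet}M_{\alpha(\kappa(F_\bullet))}$, with $M_\alpha$ the monomial quasisymmetric function. The equality is of functions of $\mathfrak{g}\in\mathfrak{G}$. *)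

theory Defs
  imports "HOL-Library.Poly_Mapping" "HOL-Library.FuncSet" "HOL-Combinatorics.Permutations"
begin

section \<open>Free vector spaces and their tensor products\<close>

text \<open>
  The free vector space on a set \<open>B\<close> over a field consists of the finitely supported functions
  with support in \<open>B\<close>. The tensor product of the free spaces on \<open>A\<close> and \<open>B\<close> is modelled by the
  free space on \<open>A \<times> B\<close>.
\<close>

definition free_space :: "'b set \<Rightarrow> ('b \<Rightarrow>\<^sub>0 'k::field) set" where
  "free_space B = {x. Poly_Mapping.keys x \<subseteq> B}"

definition scale_vec :: "'k::field \<Rightarrow> ('b \<Rightarrow>\<^sub>0 'k) \<Rightarrow> ('b \<Rightarrow>\<^sub>0 'k)" where
  "scale_vec c = Poly_Mapping.map ((*) c)"

definition linear_map ::
    "('b \<Rightarrow>\<^sub>0 'k::field) set \<Rightarrow> ('c \<Rightarrow>\<^sub>0 'k) set \<Rightarrow> (('b \<Rightarrow>\<^sub>0 'k) \<Rightarrow> ('c \<Rightarrow>\<^sub>0 'k)) \<Rightarrow> bool" where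
  "linear_map V W F \<longleftrightarrow>
     (\<forall>x\<in>V. F x \<in> W) \<and>
     (\<forall>x\<in>V. \<forall>y\<in>V. F (x + y) = F x + F y) \<and>
     (\<forall>c. \<forall>x\<in>V. F (scale_vec c x) = scale_vec c (F x))"

definition basis_vec :: "'b \<Rightarrow> ('b \<Rightarrow>\<^sub>0 'k::field)" where
  "basis_vec b = Poly_Mapping.single b 1"

definition lin_ext :: "('b \<Rightarrow> ('c \<Rightarrow>\<^sub>0 'k::field)) \<Rightarrow> ('b \<Rightarrow>\<^sub>0 'k) \<Rightarrow> ('c \<Rightarrow>\<^sub>0 'k)" where
  "lin_ext f x = (\<Sum>b\<in>Poly_Mapping.keys x. scale_vec (Poly_Mapping.lookup x b) (f b))"

definition tensor :: "('b \<Rightarrow>\<^sub>0 'k::field) \<Rightarrow> ('c \<Rightarrow>\<^sub>0 'k) \<Rightarrow> ('b \<times> 'c \<Rightarrow>\<^sub>0 'k)" where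
  "tensor x y = lin_ext (\<lambda>a. lin_ext (\<lambda>b. basis_vec (a, b)) y) x"

definition tensor_map ::
    "(('b \<Rightarrow>\<^sub>0 'k::field) \<Rightarrow> ('d \<Rightarrow>\<^sub>0 'k)) \<Rightarrow> (('c \<Rightarrow>\<^sub>0 'k) \<Rightarrow> ('e \<Rightarrow>\<^sub>0 'k)) \<Rightarrow>
     ('b \<times> 'c \<Rightarrow>\<^sub>0 'k) \<Rightarrow> ('d \<times> 'e \<Rightarrow>\<^sub>0 'k)" where
  "tensor_map F G = lin_ext (\<lambda>(a, b). tensor (F (basis_vec a)) (G (basis_vec b)))"

text \<open>The associativity and middle-four-interchange isomorphisms of tensor products.\<close>

definition tensor_assoc :: "(('b \<times> 'c) \<times> 'd \<Rightarrow>\<^sub>0 'k::field) \<Rightarrow> ('b \<times> 'c \<times> 'd \<Rightarrow>\<^sub>0 'k)" where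
  "tensor_assoc = lin_ext (\<lambda>((a, b), c). basis_vec (a, b, c))"

definition tensor_swap ::
    "(('b \<times> 'c) \<times> ('d \<times> 'e) \<Rightarrow>\<^sub>0 'k::field) \<Rightarrow> (('b \<times> 'd) \<times> ('c \<times> 'e) \<Rightarrow>\<^sub>0 'k)" where
  "tensor_swap = lin_ext (\<lambda>((a, b), (c, d)). basis_vec ((a, c), (b, d)))"


section \<open>Connected Hopf monoids in linear species\<close>

text \<open>
  Finite sets are the finite subsets of a type. A bijection \<open>M \<rightarrow> N\<close> is a function \<open>\<sigma>\<close> with
  \<open>bij_betw \<sigma> M N\<close>; only its values on \<open>M\<close> matter, and \<open>T M \<sigma>\<close> is the map that the species assigns
  to it. The space assigned to \<open>N\<close> is given with a basis, \<open>B N\<close>; the structure maps are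
  arbitrary linear maps.
\<close>

locale linear_bimonoid =
  fixes B :: "'a set \<Rightarrow> 'h set"
    and T :: "'a set \<Rightarrow> ('a \<Rightarrow> 'a) \<Rightarrow> ('h \<Rightarrow>\<^sub>0 'k::field) \<Rightarrow> ('h \<Rightarrow>\<^sub>0 'k)"
    and \<mu> :: "'a set \<Rightarrow> 'a set \<Rightarrow> ('h \<times> 'h \<Rightarrow>\<^sub>0 'k) \<Rightarrow> ('h \<Rightarrow>\<^sub>0 'k)"
    and \<Delta> :: "'a set \<Rightarrow> 'a set \<Rightarrow> ('h \<Rightarrow>\<^sub>0 'k) \<Rightarrow> ('h \<times> 'h \<Rightarrow>\<^sub>0 'k)"
    and \<eta> :: "'h \<Rightarrow>\<^sub>0 'k"
    and \<epsilon> :: "('h \<Rightarrow>\<^sub>0 'k) \<Rightarrow> 'k"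
  assumes T_linear:
      "finite M \<Longrightarrow> bij_betw \<sigma> M N \<Longrightarrow> linear_map (free_space (B M)) (free_space (B N)) (T M \<sigma>)"
    and T_cong:
      "finite M \<Longrightarrow> inj_on \<sigma> M \<Longrightarrow> (\<And>v. v \<in> M \<Longrightarrow> \<sigma> v = \<tau> v) \<Longrightarrow> x \<in> free_space (B M) \<Longrightarrow>
       T M \<sigma> x = T M \<tau> x"
    and T_id: "finite M \<Longrightarrow> x \<in> free_space (B M) \<Longrightarrow> T M id x = x"
    and T_comp:
      "finite L \<Longrightarrow> bij_betw \<sigma> L M \<Longrightarrow> bij_betw \<tau> M N \<Longrightarrow> x \<in> free_space (B L) \<Longrightarrow>
       T L (\<tau> \<circ> \<sigma>) x = T M \<tau> (T L \<sigma> x)"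
    and \<mu>_linear:
      "finite M \<Longrightarrow> finite N \<Longrightarrow> M \<inter> N = {} \<Longrightarrow>
       linear_map (free_space (B M \<times> B N)) (free_space (B (M \<union> N))) (\<mu> M N)"
    and \<Delta>_linear:
      "finite M \<Longrightarrow> finite N \<Longrightarrow> M \<inter> N = {} \<Longrightarrow>
       linear_map (free_space (B (M \<union> N))) (free_space (B M \<times> B N)) (\<Delta> M N)"
    and \<mu>_natural:
      "finite M \<Longrightarrow> finite N \<Longrightarrow> M \<inter> N = {} \<Longrightarrow> inj_on \<sigma> (M \<union> N) \<Longrightarrow>
       z \<in> free_space (B M \<times> B N) \<Longrightarrow>
       T (M \<union> N) \<sigma> (\<mu> M N z) = \<mu> (\<sigma> ` M) (\<sigma> ` N) (tensor_map (T M \<sigma>) (T N \<sigma>) z)"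
    and \<Delta>_natural:
      "finite M \<Longrightarrow> finite N \<Longrightarrow> M \<inter> N = {} \<Longrightarrow> inj_on \<sigma> (M \<union> N) \<Longrightarrow>
       x \<in> free_space (B (M \<union> N)) \<Longrightarrow>
       \<Delta> (\<sigma> ` M) (\<sigma> ` N) (T (M \<union> N) \<sigma> x) = tensor_map (T M \<sigma>) (T N \<sigma>) (\<Delta> M N x)"
    and \<mu>_assoc:
      "finite L \<Longrightarrow> finite M \<Longrightarrow> finite N \<Longrightarrow> L \<inter> M = {} \<Longrightarrow> L \<inter> N = {} \<Longrightarrow> M \<inter> N = {} \<Longrightarrow>
       w \<in> free_space ((B L \<times> B M) \<times> B N) \<Longrightarrow>
       \<mu> (L \<union> M) N (tensor_map (\<mu> L M) id w) =
         \<mu> L (M \<union> N) (tensor_map id (\<mu> M N) (tensor_assoc w))"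
    and \<Delta>_coassoc:
      "finite L \<Longrightarrow> finite M \<Longrightarrow> finite N \<Longrightarrow> L \<inter> M = {} \<Longrightarrow> L \<inter> N = {} \<Longrightarrow> M \<inter> N = {} \<Longrightarrow>
       x \<in> free_space (B (L \<union> M \<union> N)) \<Longrightarrow>
       tensor_assoc (tensor_map (\<Delta> L M) id (\<Delta> (L \<union> M) N x)) =
         tensor_map id (\<Delta> M N) (\<Delta> L (M \<union> N) x)"
    and \<eta>_in: "\<eta> \<in> free_space (B {})"
    and \<mu>_unit_left: "finite N \<Longrightarrow> x \<in> free_space (B N) \<Longrightarrow> \<mu> {} N (tensor \<eta> x) = x"
    and \<mu>_unit_right: "finite N \<Longrightarrow> x \<in> free_space (B N) \<Longrightarrow> \<mu> N {} (tensor x \<eta>) = x"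
    and \<epsilon>_add: "x \<in> free_space (B {}) \<Longrightarrow> y \<in> free_space (B {}) \<Longrightarrow> \<epsilon> (x + y) = \<epsilon> x + \<epsilon> y"
    and \<epsilon>_scale: "x \<in> free_space (B {}) \<Longrightarrow> \<epsilon> (scale_vec c x) = c * \<epsilon> x"
    and \<Delta>_counit_left:
      "finite N \<Longrightarrow> x \<in> free_space (B N) \<Longrightarrow>
       lin_ext (\<lambda>(a, b). scale_vec (\<epsilon> (basis_vec a)) (basis_vec b)) (\<Delta> {} N x) = x"
    and \<Delta>_counit_right:
      "finite N \<Longrightarrow> x \<in> free_space (B N) \<Longrightarrow>
       lin_ext (\<lambda>(a, b). scale_vec (\<epsilon> (basis_vec b)) (basis_vec a)) (\<Delta> N {} x) = x"
    and compatible: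
      "finite P \<Longrightarrow> finite Q \<Longrightarrow> finite R \<Longrightarrow> finite S \<Longrightarrow>
       P \<inter> Q = {} \<Longrightarrow> P \<inter> R = {} \<Longrightarrow> P \<inter> S = {} \<Longrightarrow> Q \<inter> R = {} \<Longrightarrow> Q \<inter> S = {} \<Longrightarrow> R \<inter> S = {} \<Longrightarrow>
       z \<in> free_space (B (P \<union> Q) \<times> B (R \<union> S)) \<Longrightarrow>
       \<Delta> (P \<union> R) (Q \<union> S) (\<mu> (P \<union> Q) (R \<union> S) z) =
         tensor_map (\<mu> P R) (\<mu> Q S) (tensor_swap (tensor_map (\<Delta> P Q) (\<Delta> R S) z))"
    and \<Delta>_\<eta>: "\<Delta> {} {} \<eta> = tensor \<eta> \<eta>"
    and \<epsilon>_\<mu>: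
      "x \<in> free_space (B {}) \<Longrightarrow> y \<in> free_space (B {}) \<Longrightarrow> \<epsilon> (\<mu> {} {} (tensor x y)) = \<epsilon> x * \<epsilon> y"
    and \<epsilon>_\<eta>: "\<epsilon> \<eta> = 1"

text \<open>
  Connected means that the space on the empty set is one-dimensional. A connected bimonoid in
  linear species has a unique antipode (Takeuchi's formula), which is therefore not part of the
  data of a connected Hopf monoid.
\<close>

definition connected_hopf_monoid ::
    "('a set \<Rightarrow> 'h set) \<Rightarrow> ('a set \<Rightarrow> ('a \<Rightarrow> 'a) \<Rightarrow> ('h \<Rightarrow>\<^sub>0 'k::field) \<Rightarrow> ('h \<Rightarrow>\<^sub>0 'k)) \<Rightarrow>
     ('a set \<Rightarrow> 'a set \<Rightarrow> ('h \<times> 'h \<Rightarrow>\<^sub>0 'k) \<Rightarrow> ('h \<Rightarrow>\<^sub>0 'k)) \<Rightarrow>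
     ('a set \<Rightarrow> 'a set \<Rightarrow> ('h \<Rightarrow>\<^sub>0 'k) \<Rightarrow> ('h \<times> 'h \<Rightarrow>\<^sub>0 'k)) \<Rightarrow> bool" where
  "connected_hopf_monoid B T \<mu> \<Delta> \<longleftrightarrow>
     card (B {}) = 1 \<and> (\<exists>\<eta> \<epsilon>. linear_bimonoid B T \<mu> \<Delta> \<eta> \<epsilon>)"


section \<open>Linearized combinatorial Hopf monoids\<close>

text \<open>In \<open>coprod\<close>, the value \<open>None\<close> stands for the extra element \<open>0\<close>.\<close>

record ('a, 'h) species_ops =
  structs :: "'a set \<Rightarrow> 'h set"
  relabel :: "'a set \<Rightarrow> ('a \<Rightarrow> 'a) \<Rightarrow> 'h \<Rightarrow> 'h"
  mprod :: "'a set \<Rightarrow> 'a set \<Rightarrow> 'h \<times> 'h \<Rightarrow> 'h"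
  coprod :: "'a set \<Rightarrow> 'a set \<Rightarrow> 'h \<Rightarrow> ('h \<times> 'h) option"

locale set_species =
  fixes H :: "('a, 'h) species_ops"
  assumes finite_structs: "finite N \<Longrightarrow> finite (structs H N)"
    and relabel_bij:
      "finite M \<Longrightarrow> bij_betw \<sigma> M N \<Longrightarrow> bij_betw (relabel H M \<sigma>) (structs H M) (structs H N)"
    and relabel_cong:
      "finite M \<Longrightarrow> inj_on \<sigma> M \<Longrightarrow> (\<And>v. v \<in> M \<Longrightarrow> \<sigma> v = \<tau> v) \<Longrightarrow> h \<in> structs H M \<Longrightarrow>
       relabel H M \<sigma> h = relabel H M \<tau> h"
    and relabel_id: "finite M \<Longrightarrow> h \<in> structs H M \<Longrightarrow> relabel H M id h = h"
    and relabel_comp: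
      "finite L \<Longrightarrow> bij_betw \<sigma> L M \<Longrightarrow> bij_betw \<tau> M N \<Longrightarrow> h \<in> structs H L \<Longrightarrow>
       relabel H L (\<tau> \<circ> \<sigma>) h = relabel H M \<tau> (relabel H L \<sigma> h)"

definition option_vec :: "'b option \<Rightarrow> ('b \<Rightarrow>\<^sub>0 'k::field)" where
  "option_vec u = (case u of None \<Rightarrow> 0 | Some b \<Rightarrow> basis_vec b)"

definition linearized_hopf_monoid :: "'k::field itself \<Rightarrow> ('a, 'h) species_ops \<Rightarrow> bool" where
  "linearized_hopf_monoid (_ :: 'k itself) H \<longleftrightarrow>
     set_species H \<and>
     card (structs H {}) = 1 \<and>
     (\<forall>M N. finite M \<and> finite N \<and> M \<inter> N = {} \<longrightarrow>
        mprod H M N \<in> structs H M \<times> structs H N \<rightarrow> structs H (M \<union> N)) \<and>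
     (\<forall>M N. finite M \<and> finite N \<and> M \<inter> N = {} \<longrightarrow>
        coprod H M N \<in> structs H (M \<union> N) \<rightarrow> insert None (Some ` (structs H M \<times> structs H N))) \<and>
     connected_hopf_monoid (structs H)
       (\<lambda>M \<sigma>. lin_ext (\<lambda>h. basis_vec (relabel H M \<sigma> h)) :: ('h \<Rightarrow>\<^sub>0 'k) \<Rightarrow> ('h \<Rightarrow>\<^sub>0 'k))
       (\<lambda>M N. lin_ext (\<lambda>p. basis_vec (mprod H M N p)))
       (\<lambda>M N. lin_ext (\<lambda>h. option_vec (coprod H M N h)))"

definition linearized_character ::
    "('a, 'h) species_ops \<Rightarrow> ('a set \<Rightarrow> 'h \<Rightarrow> nat) \<Rightarrow> bool" where
  "linearized_character H \<phi> \<longleftrightarrow>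
     (\<forall>N. finite N \<longrightarrow> (\<forall>h\<in>structs H N. \<phi> N h \<in> {0, 1})) \<and>
     (\<forall>M N \<sigma>. finite M \<and> bij_betw \<sigma> M N \<longrightarrow>
        (\<forall>h\<in>structs H M. \<phi> N (relabel H M \<sigma> h) = \<phi> M h)) \<and>
     (\<forall>M N. finite M \<and> finite N \<and> M \<inter> N = {} \<longrightarrow>
        (\<forall>x\<in>structs H M. \<forall>y\<in>structs H N. \<phi> (M \<union> N) (mprod H M N (x, y)) = \<phi> M x * \<phi> N y))"

definition balanced_convex ::
    "('a, 'h) species_ops \<Rightarrow> ('a set \<Rightarrow> 'h \<Rightarrow> nat) \<Rightarrow> bool" where
  "balanced_convex H \<phi> \<longleftrightarrow>
     (\<forall>N. finite N \<longrightarrow> (\<forall>h\<in>structs H N.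
        (card N = 1 \<longrightarrow> \<phi> N h = 1) \<and>
        (card N > 1 \<longrightarrow> (\<exists>S. S \<noteq> {} \<and> S \<subset> N \<and> coprod H S (N - S) h \<noteq> None)) \<and>
        (\<forall>S a b. S \<subseteq> N \<and> \<phi> N h = 1 \<and> coprod H S (N - S) h = Some (a, b) \<longrightarrow>
           \<phi> S a = 1 \<and> \<phi> (N - S) b = 1)))"


section \<open>Set compositions and proper colorings\<close>

text \<open>
  A set composition is the list of its blocks. The only composition of the empty set is the
  empty list, for which the iterated coproduct is the empty tuple and the character the empty product.
\<close>

fun coprod_comp :: "('a, 'h) species_ops \<Rightarrow> 'a set \<Rightarrow> 'a set list \<Rightarrow> 'h \<Rightarrow> 'h list option" where
  "coprod_comp H N [] h = Some []"
| "coprod_comp H N [C] h = Some [h]"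
| "coprod_comp H N (C # D # Cs) h =
     (case coprod H C (N - C) h of
        None \<Rightarrow> None
      | Some (a, b) \<Rightarrow> map_option ((#) a) (coprod_comp H (N - C) (D # Cs) b))"

definition char_comp ::
    "('a, 'h) species_ops \<Rightarrow> ('a set \<Rightarrow> 'h \<Rightarrow> nat) \<Rightarrow> 'a set \<Rightarrow> 'a set list \<Rightarrow> 'h \<Rightarrow> nat" where
  "char_comp H \<phi> N C h =
     (case coprod_comp H N C h of None \<Rightarrow> 0 | Some hs \<Rightarrow> prod_list (map2 \<phi> C hs))"

text \<open>
  Functions from \<open>N\<close> to the natural numbers are elements of \<open>N \<rightarrow>\<^sub>E UNIV\<close>. Permutations of \<open>N\<close>
  fix all points outside \<open>N\<close> (\<open>permutes\<close>), so they act on this set by \<open>f \<mapsto> f \<circ> inv g\<close>.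
\<close>

definition coloring_comp :: "'a set \<Rightarrow> ('a \<Rightarrow> nat) \<Rightarrow> 'a set list" where
  "coloring_comp N f = map (\<lambda>i. {v \<in> N. f v = i}) (sorted_list_of_set (f ` N))"

definition proper_coloring ::
    "('a, 'h) species_ops \<Rightarrow> ('a set \<Rightarrow> 'h \<Rightarrow> nat) \<Rightarrow> 'a set \<Rightarrow> 'h \<Rightarrow> ('a \<Rightarrow> nat) \<Rightarrow> bool" where
  "proper_coloring H \<phi> N h f \<longleftrightarrow> char_comp H \<phi> N (coloring_comp N f) h = 1"

definition struct_aut :: "('a, 'h) species_ops \<Rightarrow> 'a set \<Rightarrow> 'h \<Rightarrow> ('a \<Rightarrow> 'a) set" where
  "struct_aut H N h = {g. g permutes N \<and> relabel H N g h = h}"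


section \<open>Formal power series\<close>

text \<open>
  A formal power series in the variables \<open>x\<^sub>0, x\<^sub>1, \<dots>\<close> maps each monomial (exponent vector) to
  its coefficient.
\<close>

type_synonym fseries = "(nat \<Rightarrow>\<^sub>0 nat) \<Rightarrow> int"

text \<open>
  The formal sum of the monomials \<open>mon i\<close> over a possibly infinite index set. It is meaningful when each
  monomial arises from finitely many indices; for \<open>monomial_qsym \<alpha>\<close> this holds if the parts of \<open>\<alpha>\<close>
  are positive.
\<close>

definition monomial_sum :: "('i \<Rightarrow> (nat \<Rightarrow>\<^sub>0 nat)) \<Rightarrow> 'i set \<Rightarrow> fseries" where
  "monomial_sum mon I = (\<lambda>m. int (card {i \<in> I. mon i = m}))"

definition monomial_qsym :: "nat list \<Rightarrow> fseries" where
  "monomial_qsym \<alpha> =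
     monomial_sum (\<lambda>is. \<Sum>j<length \<alpha>. Poly_Mapping.single (is ! j) (\<alpha> ! j))
       {is. length is = length \<alpha> \<and> sorted_wrt (<) is}"

text \<open>
  Like the notation it formalizes, this and \<open>flag_qsym\<close> below carry the group as an argument,
  although the value at \<open>g\<close> does not depend on it.
\<close>

definition chromatic_qsym ::
    "('a, 'h) species_ops \<Rightarrow> ('a set \<Rightarrow> 'h \<Rightarrow> nat) \<Rightarrow> 'a set \<Rightarrow> 'h \<Rightarrow> ('a \<Rightarrow> 'a) set \<Rightarrow> ('a \<Rightarrow> 'a) \<Rightarrow> fseries" where
  "chromatic_qsym H \<phi> N h G g =
     monomial_sum (\<lambda>f. \<Sum>v\<in>N. Poly_Mapping.single (f v) 1)
       {f \<in> N \<rightarrow>\<^sub>E UNIV. proper_coloring H \<phi> N h f \<and> f \<circ> inv g = f}"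


section \<open>Coloring complexes\<close>

definition vertices :: "'a set \<Rightarrow> 'a set set" where
  "vertices N = {S. S \<noteq> {} \<and> S \<subset> N}"

definition is_flag :: "'a set \<Rightarrow> 'a set set \<Rightarrow> bool" where
  "is_flag N F \<longleftrightarrow> F \<subseteq> vertices N \<and> (\<forall>S\<in>F. \<forall>T\<in>F. S \<subseteq> T \<or> T \<subseteq> S)"

definition flag_list :: "'a set set \<Rightarrow> 'a set list" where
  "flag_list F = (THE xs. set xs = F \<and> sorted_wrt (\<subset>) xs)"

definition flag_comp :: "'a set \<Rightarrow> 'a set set \<Rightarrow> 'a set list" where
  "flag_comp N F =
     (if N = {} then [] else map2 (\<lambda>S T. T - S) ({} # flag_list F) (flag_list F @ [N]))"

definition coloring_complex ::
    "('a, 'h) species_ops \<Rightarrow> ('a set \<Rightarrow> 'h \<Rightarrow> nat) \<Rightarrow> 'a set \<Rightarrow> 'h \<Rightarrow> 'a set set set" where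
  "coloring_complex H \<phi> N h = {F. is_flag N F \<and> char_comp H \<phi> N (flag_comp N F) h = 1}"

definition complex_aut :: "'a set \<Rightarrow> 'a set set set \<Rightarrow> ('a set \<Rightarrow> 'a set) set" where
  "complex_aut N \<Phi> =
     {p. bij_betw p (vertices N) (vertices N) \<and>
         (\<forall>S\<in>vertices N. card (p S) = card S) \<and>
         (\<forall>F\<in>\<Phi>. p ` F \<in> \<Phi>)}"

definition descent_comp :: "nat \<Rightarrow> nat set \<Rightarrow> nat list" where
  "descent_comp n S =
     (if n = 0 then []
      else map2 (\<lambda>a b. b - a) (0 # sorted_list_of_set S) (sorted_list_of_set S @ [n]))"

definition flag_qsym ::
    "'a set \<Rightarrow> 'a set set set \<Rightarrow> ('a \<Rightarrow> 'a) set \<Rightarrow> ('a \<Rightarrow> 'a) \<Rightarrow> fseries" where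
  "flag_qsym N \<Phi> G g =
     (\<lambda>m. \<Sum>F\<in>{F \<in> \<Phi>. (\<lambda>S. g ` S) ` F = F}. monomial_qsym (descent_comp (card N) (card ` F)) m)"

end

theory Submission
  imports Defs
begin

text \<open>
  A coloring \<open>f\<close> of a nonempty set is the same thing as the flag of its proper sublevel sets together
  with the increasing list of its values. Under this correspondence the set composition of \<open>f\<close> is that
  of the flag, so \<open>f\<close> is proper iff the flag is a face, and the monomials of the colorings with a given
  flag are those of the monomial quasisymmetric function. A permutation fixes \<open>f\<close> iff it fixes the
  flag: it preserves cardinalities, so it fixes a chain of sets only if it fixes every member.
\<close>

section \<open>Naturality of the iterated coproduct\<close>

lemma scale_vec_1 [simp]: "scale_vec 1 x = x"
  unfolding scale_vec_def
  by (intro poly_mapping_eqI) (simp add: Poly_Mapping.map.rep_eq when_def)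

lemma lin_ext_basis_vec [simp]: "lin_ext f (basis_vec b) = f b"
  by (simp add: lin_ext_def basis_vec_def lookup_single)

lemma lin_ext_zero [simp]: "lin_ext f 0 = 0"
  by (simp add: lin_ext_def)

lemma tensor_basis_vec [simp]: "tensor (basis_vec a) (basis_vec b) = basis_vec (a, b)"
  by (simp add: tensor_def)

lemma option_vec_simps [simp]: "option_vec None = 0" "option_vec (Some b) = basis_vec b"
  by (simp_all add: option_vec_def)

lemma basis_vec_neq_0 [simp]: "(basis_vec b :: 'b \<Rightarrow>\<^sub>0 'k::field) \<noteq> 0"
  unfolding basis_vec_def by (metis lookup_single_eq lookup_zero zero_neq_one)

lemma basis_vec_inject [simp]:
  "(basis_vec a :: 'b \<Rightarrow>\<^sub>0 'k::field) = basis_vec b \<longleftrightarrow> a = b"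
  unfolding basis_vec_def by (metis keys_single singleton_inject zero_neq_one)

text \<open>Basis vectors are distinct and nonzero, so an identity between vectors of this form,
  zero included, can be read back at the level of sets.\<close>

lemma option_vec_inject:
  "(option_vec u :: 'b \<Rightarrow>\<^sub>0 'k::field) = option_vec v \<longleftrightarrow> u = v"
proof (cases u; cases v)
  fix b assume "u = None" "v = Some b"
  then show ?thesis using basis_vec_neq_0[of b, symmetric] by simp
qed simp_all

text \<open>Naturality is given for the linearized coproduct. Evaluated at the basis vector of
  \<open>h\<close>, both sides become values of \<open>option_vec\<close>, whose injectivity yields
  the set-level identity.\<close>

lemma coprod_natural:
  fixes H :: "('a, 'h) species_ops"
  assumes hopf: "linearized_hopf_monoid TYPE('k::field) H"
    and "finite M" "finite N" "M \<inter> N = {}" "inj_on \<sigma> (M \<union> N)" "h \<in> structs H (M \<union> N)"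
  shows "coprod H (\<sigma> ` M) (\<sigma> ` N) (relabel H (M \<union> N) \<sigma> h) =
    map_option (\<lambda>(a, b). (relabel H M \<sigma> a, relabel H N \<sigma> b)) (coprod H M N h)"
proof -
  obtain \<eta> :: "'h \<Rightarrow>\<^sub>0 'k" and \<epsilon> where bimonoid: "linear_bimonoid (structs H)
       (\<lambda>M \<sigma>. lin_ext (\<lambda>h. basis_vec (relabel H M \<sigma> h)))
       (\<lambda>M N. lin_ext (\<lambda>p. basis_vec (mprod H M N p)))
       (\<lambda>M N. lin_ext (\<lambda>h. option_vec (coprod H M N h))) \<eta> \<epsilon>"
    using hopf unfolding linearized_hopf_monoid_def connected_hopf_monoid_def by (elim conjE exE)
  have "(basis_vec h :: 'h \<Rightarrow>\<^sub>0 'k) \<in> free_space (structs H (M \<union> N))"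
    using assms by (simp add: free_space_def basis_vec_def)
  from linear_bimonoid.\<Delta>_natural[OF bimonoid assms(2-5) this]
  have "(option_vec (coprod H (\<sigma> ` M) (\<sigma> ` N) (relabel H (M \<union> N) \<sigma> h)) :: _ \<Rightarrow>\<^sub>0 'k) =
    option_vec (map_option (\<lambda>(a, b). (relabel H M \<sigma> a, relabel H N \<sigma> b)) (coprod H M N h))"
    by (cases "coprod H M N h") (auto simp: tensor_map_def)
  then show ?thesis by (simp add: option_vec_inject)
qed

lemma coprod_in_structs:
  assumes "linearized_hopf_monoid TYPE('k::field) H" "finite N" "S \<subseteq> N" "h \<in> structs H N"
    and "coprod H S (N - S) h = Some (a, b)"
  shows "a \<in> structs H S" "b \<in> structs H (N - S)"
proof -
  have "\<forall>M N. finite M \<and> finite N \<and> M \<inter> N = {} \<longrightarrow>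
      coprod H M N \<in> structs H (M \<union> N) \<rightarrow> insert None (Some ` (structs H M \<times> structs H N))"
    using assms(1) unfolding linearized_hopf_monoid_def by (elim conjE)
  moreover have "finite S" "finite (N - S)" "S \<inter> (N - S) = {}" "S \<union> (N - S) = N"
    using assms(2,3) finite_subset by auto
  ultimately have "coprod H S (N - S) \<in>
      structs H N \<rightarrow> insert None (Some ` (structs H S \<times> structs H (N - S)))"
    by metis
  then have "coprod H S (N - S) h \<in> insert None (Some ` (structs H S \<times> structs H (N - S)))"
    using assms(4) by blast
  with assms(5) show "a \<in> structs H S" "b \<in> structs H (N - S)" by auto
qed

text \<open>Empty blocks are allowed. The recursion through complements mirrors that of
  \<open>coprod_comp\<close>, so one induction can follow both.\<close>

fun set_composition :: "'a set \<Rightarrow> 'a set list \<Rightarrow> bool" where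
  "set_composition N [] \<longleftrightarrow> N = {}"
| "set_composition N (C # Cs) \<longleftrightarrow> C \<subseteq> N \<and> set_composition (N - C) Cs"

text \<open>If a later coproduct vanishes, the factor of the tail is 0, so the product form in the
  last equation covers that case too.\<close>

lemma char_comp_simps:
  "char_comp H \<phi> N [] h = 1"
  "char_comp H \<phi> N [C] h = \<phi> C h"
  "char_comp H \<phi> N (C # D # Cs) h =
     (case coprod H C (N - C) h of None \<Rightarrow> 0
      | Some (a, b) \<Rightarrow> \<phi> C a * char_comp H \<phi> (N - C) (D # Cs) b)"
  by (auto simp: char_comp_def split: option.splits)

lemma linearized_character_relabel:
  assumes "linearized_character H \<phi>" "finite M" "inj_on \<sigma> M" "h \<in> structs H M"
  shows "\<phi> (\<sigma> ` M) (relabel H M \<sigma> h) = \<phi> M h"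
proof -
  have "\<forall>M N \<sigma>. finite M \<and> bij_betw \<sigma> M N \<longrightarrow>
      (\<forall>h\<in>structs H M. \<phi> N (relabel H M \<sigma> h) = \<phi> M h)"
    using assms(1) unfolding linearized_character_def by (elim conjE)
  with assms show ?thesis by (simp add: inj_on_imp_bij_betw)
qed

text \<open>Naturality of the coproduct handles splitting off the first block; the induction
  hypothesis then applies to \<open>\<sigma>\<close> on the complement. One-block lists form a
  separate case, as they do in \<open>coprod_comp\<close>.\<close>

lemma char_comp_natural:
  assumes hopf: "linearized_hopf_monoid TYPE('k::field) H" and char: "linearized_character H \<phi>"
  shows "\<lbrakk>finite N; inj_on \<sigma> N; h \<in> structs H N; set_composition N Cs\<rbrakk> \<Longrightarrow>
    char_comp H \<phi> (\<sigma> ` N) (map ((`) \<sigma>) Cs) (relabel H N \<sigma> h) = char_comp H \<phi> N Cs h"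
proof (induction Cs arbitrary: N h rule: induct_list012)
  case 1
  then show ?case by (simp add: char_comp_simps)
next
  case (2 C)
  \<comment> \<open>The one-block equation evaluates \<open>\<phi>\<close> at \<open>C\<close>,
    whereas \<open>h\<close> lives on \<open>N\<close>; the last block is the whole remaining
    set.\<close>
  have [simp]: "C = N" using \<open>set_composition N [C]\<close> by auto
  have "\<phi> (\<sigma> ` N) (relabel H N \<sigma> h) = \<phi> N h"
    using linearized_character_relabel[OF char \<open>finite N\<close> \<open>inj_on \<sigma> N\<close> \<open>h \<in> structs H N\<close>] .
  then show ?case by (simp add: char_comp_simps)
next
  case (3 C D Cs)
  note IH = \<open>\<And>N h. \<lbrakk>finite N; inj_on \<sigma> N; h \<in> structs H N; set_composition N (D # Cs)\<rbrakk> \<Longrightarrow>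
    char_comp H \<phi> (\<sigma> ` N) (map ((`) \<sigma>) (D # Cs)) (relabel H N \<sigma> h) = char_comp H \<phi> N (D # Cs) h\<close>
  note fin = \<open>finite N\<close> and inj = \<open>inj_on \<sigma> N\<close> and h = \<open>h \<in> structs H N\<close>
  have sub: "C \<subseteq> N" and comp: "set_composition (N - C) (D # Cs)"
    using \<open>set_composition N (C # D # Cs)\<close> by simp_all
  have un: "C \<union> (N - C) = N" and disj: "C \<inter> (N - C) = {}" using sub by auto
  have fin': "finite C" "finite (N - C)" using fin sub finite_subset by auto
  have inj': "inj_on \<sigma> C" "inj_on \<sigma> (N - C)" using inj sub inj_on_subset by blast+
  have diff: "\<sigma> ` N - \<sigma> ` C = \<sigma> ` (N - C)"
    using inj_on_image_set_diff[OF inj Diff_subset sub] by simp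
  have nat: "coprod H (\<sigma> ` C) (\<sigma> ` (N - C)) (relabel H N \<sigma> h) =
     map_option (\<lambda>(a, b). (relabel H C \<sigma> a, relabel H (N - C) \<sigma> b)) (coprod H C (N - C) h)"
    by (rule coprod_natural[OF hopf fin' disj, unfolded un, OF inj h])
  show ?case
  proof (cases "coprod H C (N - C) h")
    case None
    then show ?thesis using nat diff by (simp add: char_comp_simps)
  next
    case (Some p)
    obtain a b where p: "p = (a, b)" by fastforce
    note ab = coprod_in_structs[OF hopf fin sub h Some[unfolded p]]
    have "\<phi> (\<sigma> ` C) (relabel H C \<sigma> a) = \<phi> C a"
      by (rule linearized_character_relabel[OF char fin'(1) inj'(1) ab(1)])
    moreover note IH[OF fin'(2) inj'(2) ab(2) comp]
    ultimately show ?thesis using nat diff Some p by (simp add: char_comp_simps)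
  qed
qed

section \<open>Flags as sorted lists\<close>

text \<open>The head of each list is the least member for inclusion, hence the same in both. This
  makes the \<open>THE\<close> in \<open>flag_list\<close> determinate.\<close>

lemma sorted_wrt_psubset_unique:
  assumes "sorted_wrt (\<subset>) xs" "sorted_wrt (\<subset>) ys" "set xs = set (ys :: 'a set list)"
  shows "xs = ys"
  using assms
proof (induction xs arbitrary: ys)
  case Nil
  then show ?case by simp
next
  case (Cons x xs)
  then obtain y zs where ys: "ys = y # zs" by (cases ys) auto
  have "x = y" using Cons.prems ys by (metis insert_iff list.simps(15) psubset_eq sorted_wrt.simps(2) subset_antisym)
  moreover have "x \<notin> set xs" "y \<notin> set zs" using Cons.prems ys by auto
  ultimately have "set xs = set zs" using Cons.prems ys by auto
  then show ?case using Cons ys \<open>x = y\<close> by simp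
qed

lemma flag_list_eqI:
  assumes "set xs = F" "sorted_wrt (\<subset>) xs"
  shows "flag_list F = xs"
  unfolding flag_list_def
proof (rule the_equality)
  show "set xs = F \<and> sorted_wrt (\<subset>) xs" using assms ..
  show "ys = xs" if "set ys = F \<and> sorted_wrt (\<subset>) ys" for ys
    using that assms sorted_wrt_psubset_unique[of ys xs] by simp
qed

text \<open>Members are inserted in weakly increasing order of cardinality. A new member is
  comparable with the old ones and at least as large, so it contains each of them strictly and goes
  to the end of the list.\<close>

lemma chain_sorted_list:
  assumes "finite F" "\<forall>S\<in>F. finite S" "\<forall>S\<in>F. \<forall>T\<in>F. S \<subseteq> T \<or> T \<subseteq> S"
  shows "\<exists>xs. set xs = F \<and> sorted_wrt (\<subset>) xs"
  using assms
proof (induction F rule: finite_ranking_induct[where f = card])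
  case empty
  show ?case by (intro exI[of _ "[]"]) simp
next
  case (insert S F)
  then obtain xs where xs: "set xs = F" "sorted_wrt (\<subset>) xs" by auto
  show ?case
  proof (cases "S \<in> F")
    case True
    then show ?thesis using xs by (auto simp: insert_absorb)
  next
    case False
    have "T \<subset> S" if "T \<in> F" for T
    proof -
      have "T \<noteq> S" "card T \<le> card S" "T \<subseteq> S \<or> S \<subseteq> T" "finite T"
        using that False insert by auto
      then show ?thesis using card_seteq[of T S] by blast
    qed
    with xs show ?thesis by (intro exI[of _ "xs @ [S]"]) (simp add: sorted_wrt_append)
  qed
qed

lemma is_flag_finite:
  assumes "finite N" "is_flag N F"
  shows "finite F" "\<And>S. S \<in> F \<Longrightarrow> finite S"
proof -
  have "F \<subseteq> Pow N" using assms by (auto simp: is_flag_def vertices_def)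
  then show "finite F" "\<And>S. S \<in> F \<Longrightarrow> finite S" using assms(1) by (auto intro: finite_subset)
qed

lemma flag_list:
  assumes "finite N" "is_flag N F"
  shows "set (flag_list F) = F" "sorted_wrt (\<subset>) (flag_list F)"
proof -
  obtain xs where "set xs = F" "sorted_wrt (\<subset>) xs"
    using chain_sorted_list[of F] is_flag_finite[OF assms] assms(2) by (auto simp: is_flag_def)
  with flag_list_eqI[OF this] show "set (flag_list F) = F" "sorted_wrt (\<subset>) (flag_list F)" by auto
qed

text \<open>The two ends used by \<open>flag_comp\<close> extend the flag to one strict chain from
  \<open>{}\<close> to \<open>N\<close>. For empty \<open>N\<close> the ends would coincide.\<close>

lemma flag_list_sorted_ends:
  assumes "finite N" "is_flag N F" "N \<noteq> {}"
  shows "sorted_wrt (\<subset>) ({} # flag_list F @ [N])"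
  using flag_list[OF assms(1,2)] assms(2,3)
  by (auto simp: sorted_wrt_append is_flag_def vertices_def)

lemma length_flag_list:
  assumes "finite N" "is_flag N F"
  shows "length (flag_list F) = card F"
proof -
  have "distinct (flag_list F)"
    using flag_list(2)[OF assms] by (auto simp: sorted_wrt_iff_nth_less distinct_conv_nth nat_neq_iff)
  then have "length (flag_list F) = card (set (flag_list F))" by (simp add: distinct_card)
  then show ?thesis using flag_list(1)[OF assms] by simp
qed

text \<open>Removing \<open>T - S\<close> from \<open>N - S\<close> leaves \<open>N - T\<close>, so
  the differences telescope. The starting set \<open>S\<close> is kept general for the
  induction.\<close>

lemma set_composition_chain:
  "sorted_wrt (\<subset>) (S # xs @ [N]) \<Longrightarrow>
    set_composition (N - S) (map2 (\<lambda>S T. T - S) (S # xs) (xs @ [N]))"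
proof (induction xs arbitrary: S)
  case Nil
  then show ?case by simp
next
  case (Cons T xs)
  have "N - S - (T - S) = N - T" using Cons.prems by auto
  then show ?case using Cons by auto
qed

lemma set_composition_flag_comp:
  assumes "finite N" "is_flag N F"
  shows "set_composition N (flag_comp N F)"
  using set_composition_chain[OF flag_list_sorted_ends[OF assms]] by (auto simp: flag_comp_def)

section \<open>Permutations acting on flags\<close>

lemma image_psubset_iff: "inj g \<Longrightarrow> g ` S \<subset> g ` T \<longleftrightarrow> S \<subset> T"
  by (simp add: psubset_eq inj_image_subset_iff inj_image_eq_iff)

lemma permutes_vertices:
  assumes "g permutes N" "S \<in> vertices N"
  shows "g ` S \<in> vertices N"
  using assms(2) image_psubset_iff[OF permutes_inj[OF assms(1)], of S N] permutes_image[OF assms(1)]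
  by (simp add: vertices_def)

lemma flag_image:
  assumes "finite N" "is_flag N F" "g permutes N"
  shows "is_flag N ((`) g ` F)"
    and "flag_comp N ((`) g ` F) = map ((`) g) (flag_comp N F)"
proof -
  have inj: "inj g" and N: "g ` N = N" using assms(3) by (auto simp: permutes_inj permutes_image)
  have chain: "S \<subseteq> T \<or> T \<subseteq> S" if "S \<in> F" "T \<in> F" for S T
    using assms(2) that by (simp add: is_flag_def)
  show "is_flag N ((`) g ` F)"
    unfolding is_flag_def
  proof (intro conjI ballI image_subsetI)
    show "g ` S \<in> vertices N" if "S \<in> F" for S
      using that assms(2) permutes_vertices[OF assms(3)] by (auto simp: is_flag_def)
    show "S' \<subseteq> T' \<or> T' \<subseteq> S'" if ST: "S' \<in> (`) g ` F" "T' \<in> (`) g ` F" for S' T'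
    proof -
      obtain S T where "S \<in> F" "T \<in> F" "S' = g ` S" "T' = g ` T" using ST by auto
      then show ?thesis using chain[of S T] by (simp add: inj_image_subset_iff[OF inj])
    qed
  qed
  have "flag_list ((`) g ` F) = map ((`) g) (flag_list F)"
    using flag_list[OF assms(1,2)] 
    by (intro flag_list_eqI) (simp_all add: sorted_wrt_map image_psubset_iff[OF inj])
  \<comment> \<open>The permutation fixes both ends \<open>{}\<close> and \<open>N\<close>, so it
    can be pulled out of the padded lists whose differences are taken.\<close>
  moreover have "map ((`) g) (flag_list F) @ [N] = map ((`) g) (flag_list F @ [N])"
    "{} # map ((`) g) (flag_list F) = map ((`) g) ({} # flag_list F)" using N by simp_all
  ultimately show "flag_comp N ((`) g ` F) = map ((`) g) (flag_comp N F)"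
    by (simp add: flag_comp_def zip_map_map image_set_diff[OF inj] case_prod_unfold
        del: list.map(2) map_append)
qed

text \<open>Cardinality is strictly monotone on the finite sets of the flag, so sorting the ranks
  reproduces the order of the flag; cardinalities of nested differences then subtract.\<close>

lemma descent_comp_flag:
  assumes "finite N" "is_flag N F"
  shows "descent_comp (card N) (card ` F) = map card (flag_comp N F)"
proof (cases "N = {}")
  case True
  then show ?thesis by (simp add: descent_comp_def flag_comp_def)
next
  case False
  let ?xs = "flag_list F"
  note F = flag_list[OF assms] and fin = is_flag_finite[OF assms]
  have sub: "({} # ?xs) ! i \<subseteq> (?xs @ [N]) ! i" and fin': "finite (({} # ?xs) ! i)"
    if "i < Suc (length ?xs)" for i
  proof -
    \<comment> \<open>The entries at \<open>i\<close> of the two padded lists are neighbours, at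
      positions \<open>i\<close> and \<open>Suc i\<close>, in a single strict chain.\<close>
    have eq: "({} # ?xs) ! i = ({} # ?xs @ [N]) ! i" "(?xs @ [N]) ! i = ({} # ?xs @ [N]) ! Suc i"
      using that by (auto simp: nth_Cons nth_append split: nat.splits)
    show "({} # ?xs) ! i \<subseteq> (?xs @ [N]) ! i"
      unfolding eq using sorted_wrt_nth_less[OF flag_list_sorted_ends[OF assms False], of i "Suc i"] that
      by auto
    show "finite (({} # ?xs) ! i)" using that fin F(1) nth_mem[of "i - 1" ?xs]
      by (cases i) auto
  qed
  have "sorted_wrt (<) (map card ?xs)"
    unfolding sorted_wrt_map using F fin
    by (intro sorted_wrt_mono_rel[OF _ F(2)]) (auto intro: psubset_card_mono)
  then have "sorted_list_of_set (card ` F) = map card ?xs"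
    using F(1) strict_sorted_equal[of "sorted_list_of_set (card ` F)" "map card ?xs"] fin(1) by auto
  moreover have "(0 # map card ?xs) = map card ({} # ?xs)"
    "map card ?xs @ [card N] = map card (?xs @ [N])" by simp_all
  ultimately have "descent_comp (card N) (card ` F) =
      map2 (\<lambda>a b. b - a) (map card ({} # ?xs)) (map card (?xs @ [N]))"
    using False assms(1) by (simp add: descent_comp_def)
  also have "\<dots> = map card (flag_comp N F)"
    using False sub fin'
    by (intro nth_equalityI)
      (simp_all add: flag_comp_def card_Diff_subset del: list.map(2) map_append)
  finally show ?thesis .
qed

text \<open>The image of \<open>S\<close> lies in the same flag, hence is comparable with
  \<open>S\<close>; comparable finite sets of equal size coincide.\<close>

lemma permutes_fixes_flag_members:
  assumes "finite N" "is_flag N F" "g permutes N" "(`) g ` F = F" "S \<in> F"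
  shows "g ` S = S"
proof -
  have "finite S" "finite (g ` S)" using is_flag_finite[OF assms(1,2)] assms(5) by auto
  moreover have "card (g ` S) = card S"
    using assms(3) by (auto intro: card_image inj_on_subset permutes_inj)
  moreover have "g ` S \<subseteq> S \<or> S \<subseteq> g ` S"
    using assms(2,4,5) unfolding is_flag_def by blast
  ultimately show ?thesis using card_subset_eq by metis
qed

section \<open>The flag of a coloring\<close>

definition sublevel :: "'a set \<Rightarrow> ('a \<Rightarrow> nat) \<Rightarrow> nat \<Rightarrow> 'a set" where
  "sublevel N f i = {v \<in> N. f v \<le> i}"

text \<open>Only attained values serve as levels, which makes the sublevel sets nonempty and
  pairwise distinct. The largest value gives \<open>N\<close>, which is not a vertex.\<close>

definition coloring_flag :: "'a set \<Rightarrow> ('a \<Rightarrow> nat) \<Rightarrow> 'a set set" where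
  "coloring_flag N f = sublevel N f ` f ` N - {N}"

lemma is_flag_coloring_flag: "is_flag N (coloring_flag N f)"
  unfolding is_flag_def coloring_flag_def vertices_def sublevel_def
  by (auto dest: le_trans)

lemma flag_list_coloring_flag:
  assumes "finite N" "N \<noteq> {}"
  shows "flag_list (coloring_flag N f) @ [N] = map (sublevel N f) (sorted_list_of_set (f ` N))"
proof -
  define cs where "cs = sorted_list_of_set (f ` N)"
  have cs: "set cs = f ` N" "sorted_wrt (<) cs" using assms by (auto simp: cs_def)
  \<comment> \<open>Here \<open>k\<close> is the largest value of \<open>f\<close>: its sublevel set
    is the entry \<open>N\<close> that the flag lacks.\<close>
  then obtain js k where split: "cs = js @ [k]" using assms by (metis image_is_empty list.set(1) rev_exhaust)
  have top: "f v \<le> k" if "v \<in> N" for v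
  proof -
    have "f v \<in> set cs" using that cs by simp
    then show ?thesis using cs(2) split by (auto simp: sorted_wrt_append)
  qed
  have less: "sublevel N f i \<subset> sublevel N f j" if ij: "i < j" "j \<in> f ` N" for i j
  proof
    show "sublevel N f i \<subseteq> sublevel N f j" using ij by (auto simp: sublevel_def)
    obtain v where "v \<in> N" "f v = j" using ij by auto
    then have "v \<in> sublevel N f j" "v \<notin> sublevel N f i" using ij by (auto simp: sublevel_def)
    then show "sublevel N f i \<noteq> sublevel N f j" by blast
  qed
  have N: "sublevel N f k = N" using top by (auto simp: sublevel_def)
  have "flag_list (coloring_flag N f) = map (sublevel N f) js"
  proof (rule flag_list_eqI)
    have "k \<in> f ` N" using cs(1) split by auto
    moreover have "i < k" if "i \<in> set js" for i using that cs(2) split by (simp add: sorted_wrt_append)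
    ultimately have "sublevel N f i \<noteq> N" if "i \<in> set js" for i
      using less[of i k] that N by auto
    then show "set (map (sublevel N f) js) = coloring_flag N f"
      unfolding coloring_flag_def cs(1)[symmetric] split using N by auto
    show "sorted_wrt (\<subset>) (map (sublevel N f) js)"
      unfolding sorted_wrt_map
    proof (rule sorted_wrt_mono_rel)
      show "sorted_wrt (<) js" using cs split by (simp add: sorted_wrt_append)
      show "sublevel N f i \<subset> sublevel N f j" if "i \<in> set js" "j \<in> set js" "i < j" for i j
        using that less[of i j] cs(1) split by auto
    qed
  qed
  then show ?thesis unfolding cs_def[symmetric] using split N by simp
qed

text \<open>No value of \<open>f\<close> lies strictly between two neighbours in \<open>cs\<close>,
  so consecutive sublevel sets differ by exactly one fibre.\<close>

lemma flag_comp_coloring_flag: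
  assumes "finite N"
  shows "flag_comp N (coloring_flag N f) = coloring_comp N f"
proof (cases "N = {}")
  case True
  then show ?thesis by (simp add: flag_comp_def coloring_comp_def)
next
  case False
  define cs where "cs = sorted_list_of_set (f ` N)"
  have cs: "set cs = f ` N" "sorted_wrt (<) cs" using assms by (auto simp: cs_def)
  let ?xs = "flag_list (coloring_flag N f)"
  have xs: "?xs @ [N] = map (sublevel N f) cs"
    unfolding cs_def by (rule flag_list_coloring_flag[OF assms False])
  then have len: "length cs = Suc (length ?xs)" by (metis length_append_singleton length_map)
  have nth: "?xs ! i = sublevel N f (cs ! i)" if "i < length ?xs" for i
    using that len arg_cong[OF xs, of "\<lambda>ys. ys ! i"] by (simp add: nth_append)
  have "sublevel N f (cs ! i) - ({} # ?xs) ! i = {v \<in> N. f v = cs ! i}" if "i < length cs" for i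
  proof -
    \<comment> \<open>The subtracted set is empty for \<open>i = 0\<close> and otherwise the
      sublevel set of the preceding value; in both cases it collects the points of smaller
      value.\<close>
    have "v \<in> ({} # ?xs) ! i \<longleftrightarrow> f v < cs ! i" if "v \<in> N" for v
    proof -
      obtain k where k: "k < length cs" "f v = cs ! k"
        using \<open>v \<in> N\<close> cs(1) by (metis image_eqI in_set_conv_nth)
      have mono: "cs ! p < cs ! q \<longleftrightarrow> p < q" if "p < length cs" "q < length cs" for p q
        using that sorted_wrt_nth_less[OF cs(2)] by (metis linorder_neqE_nat less_asym)
      show ?thesis
      proof (cases i)
        case 0
        then show ?thesis using mono k \<open>i < length cs\<close> by auto
      next
        case (Suc j)
        then have "v \<in> ({} # ?xs) ! i \<longleftrightarrow> \<not> cs ! j < cs ! k"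
          using nth[of j] len \<open>i < length cs\<close> k \<open>v \<in> N\<close> by (auto simp: sublevel_def)
        also have "\<dots> \<longleftrightarrow> k < i" using mono[of j k] Suc k \<open>i < length cs\<close> by auto
        finally show ?thesis using mono[of k i] k \<open>i < length cs\<close> by simp
      qed
    qed
    then show ?thesis using \<open>i < length cs\<close> by (auto simp: sublevel_def)
  qed
  then show ?thesis
    using False len xs by (simp add: flag_comp_def coloring_comp_def list_eq_iff_nth_eq flip: cs_def)
qed

lemma proper_coloring_iff:
  assumes "finite N"
  shows "proper_coloring H \<phi> N h f \<longleftrightarrow> coloring_flag N f \<in> coloring_complex H \<phi> N h"
  using assms
  by (simp add: proper_coloring_def coloring_complex_def flag_comp_coloring_flag is_flag_coloring_flag)

lemma coloring_fixed_iff: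
  assumes "finite N" "g permutes N"
  shows "f \<circ> inv g = f \<longleftrightarrow> (`) g ` coloring_flag N f = coloring_flag N f"
proof
  assume "f \<circ> inv g = f"
  then have fg: "f (g v) = f v" for v using assms(2) by (metis comp_apply permutes_inverses(2))
  have "g ` sublevel N f i = sublevel N f i" for i
  proof -
    \<comment> \<open>An inclusion suffices, since the image has the same finite
      cardinality.\<close>
    have "g ` sublevel N f i \<subseteq> sublevel N f i"
      using fg permutes_in_image[OF assms(2)] by (auto simp: sublevel_def)
    then show ?thesis
      using assms by (intro card_subset_eq)
        (auto simp: sublevel_def card_image inj_on_subset[OF permutes_inj])
  qed
  then have "\<And>S. S \<in> coloring_flag N f \<Longrightarrow> g ` S = S" by (auto simp: coloring_flag_def)
  then show "(`) g ` coloring_flag N f = coloring_flag N f" by force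
next
  assume fixed: "(`) g ` coloring_flag N f = coloring_flag N f"
  have lev: "g ` sublevel N f i = sublevel N f i" if "i \<in> f ` N" for i
  proof (cases "sublevel N f i = N")
    \<comment> \<open>The top sublevel set is absent from the flag, so its invariance comes from
      \<open>g\<close> permuting \<open>N\<close>.\<close>
    case True
    then show ?thesis using assms(2) by (simp add: permutes_image)
  next
    case False
    then have "sublevel N f i \<in> coloring_flag N f" using that by (auto simp: coloring_flag_def)
    then show ?thesis
      using permutes_fixes_flag_members[OF assms(1) is_flag_coloring_flag assms(2) fixed] by blast
  qed
  have iff: "f (g v) \<le> i \<longleftrightarrow> f v \<le> i" if "v \<in> N" "i \<in> f ` N" for v i
  proof -
    have "g v \<in> sublevel N f i \<longleftrightarrow> v \<in> sublevel N f i"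
      using lev[OF that(2)] permutes_inj[OF assms(2)] by (metis inj_image_mem_iff)
    then show ?thesis using that permutes_in_image[OF assms(2)] by (simp add: sublevel_def)
  qed
  have "f (g v) = f v" for v
  proof (cases "v \<in> N")
    case True
    then have "g v \<in> N" using permutes_in_image[OF assms(2)] by simp
    \<comment> \<open>The two thresholds \<open>f v\<close> and \<open>f (g v)\<close>, both
      attained, give the two inequalities.\<close>
    then show ?thesis using True iff[of v "f v"] iff[of v "f (g v)"] by auto
  next
    case False
    then show ?thesis using assms(2) by (simp add: permutes_def)
  qed
  then show "f \<circ> inv g = f" using assms(2) by (metis comp_def ext permutes_inverses(1))
qed

section \<open>Colorings with a given flag\<close>

text \<open>
  In the coloring with flag \<open>F\<close> and values \<open>is\<close>, the position of the value of \<open>v\<close> in \<open>is\<close> is the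
  number of members of \<open>F\<close> that avoid \<open>v\<close>.
\<close>

lemma coloring_with_flag_exists:
  assumes "finite N" "is_flag N F" "N \<noteq> {}" "length is = Suc (card F)" "sorted_wrt (<) is"
  shows "\<exists>f \<in> N \<rightarrow>\<^sub>E UNIV. coloring_flag N f = F \<and> sorted_list_of_set (f ` N) = is"
proof -
  define r where "r v = card {S \<in> F. v \<notin> S}" for v
  define f where "f = (\<lambda>v\<in>N. is ! r v)"
  \<comment> \<open>Appending \<open>N\<close> gives one entry for each value in \<open>is\<close>,
    and every point of \<open>N\<close> lies in the last entry.\<close>
  define ys where "ys = flag_list F @ [N]"
  note finF = is_flag_finite[OF assms(1,2)] and F = flag_list[OF assms(1,2)]
  have len: "length ys = Suc (card F)" by (simp add: ys_def length_flag_list[OF assms(1,2)])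
  have sorted: "sorted_wrt (\<subset>) ({} # ys)"
    unfolding ys_def by (rule flag_list_sorted_ends[OF assms(1-3)])
  then have ys: "ys ! i \<subset> ys ! j" if "i < j" "j < length ys" for i j
    using that sorted_wrt_nth_less[of "(\<subset>)" ys i j] by auto
  have nonempty: "ys ! j \<noteq> {}" if "j < length ys" for j
    using sorted nth_mem[OF that] by auto
  have set_ys: "set ys = insert N F" using F by (simp add: ys_def)
  have ys_F: "ys ! j \<in> F" if "j < card F" for j
    using that F(1) nth_mem[of j "flag_list F"] length_flag_list[OF assms(1,2)]
    by (simp add: ys_def nth_append)
  have inj_ys: "inj_on ((!) ys) {..<length ys}"
    by (rule inj_onI) (metis lessThan_iff linorder_neqE_nat psubset_eq ys)
  have r_less: "r v < length ys" for v
    using card_mono[OF finF(1), of "{S \<in> F. v \<notin> S}"] len by (simp add: r_def less_Suc_eq_le)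
  \<comment> \<open>As \<open>ys\<close> increases, a member of \<open>F\<close> avoiding
    \<open>v\<close> must precede any entry containing \<open>v\<close>. Conversely, if
    \<open>ys ! j\<close> avoids \<open>v\<close>, then so do all \<open>Suc j\<close> entries up to
    it, each a member of \<open>F\<close>.\<close>
  have r_le: "r v \<le> j \<longleftrightarrow> v \<in> ys ! j" if "v \<in> N" "j < length ys" for v j
  proof
    assume "v \<in> ys ! j"
    have "{S \<in> F. v \<notin> S} \<subseteq> (!) ys ` {..<j}"
    proof
      fix S assume S: "S \<in> {S \<in> F. v \<notin> S}"
      then obtain i where i: "i < length ys" "S = ys ! i"
        using set_ys by (metis (no_types, lifting) in_set_conv_nth insertCI mem_Collect_eq)
      have "i < j"
        using S i ys[of j i] \<open>v \<in> ys ! j\<close> by (metis linorder_neqE_nat mem_Collect_eq psubsetD)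
      then show "S \<in> (!) ys ` {..<j}" using i by auto
    qed
    then have "r v \<le> card ((!) ys ` {..<j})" unfolding r_def by (intro card_mono) auto
    also have "\<dots> \<le> j" using card_image_le[of "{..<j}"] by simp
    finally show "r v \<le> j" .
  next
    assume "r v \<le> j"
    show "v \<in> ys ! j"
    proof (rule ccontr)
      assume v: "v \<notin> ys ! j"
      have "j \<noteq> card F" using v \<open>v \<in> N\<close> length_flag_list[OF assms(1,2)] by (auto simp: ys_def nth_append)
      then have j: "j < card F" using that len by simp
      have "v \<notin> ys ! i" if "i \<le> j" for i
        using v ys[of i j] that \<open>j < length ys\<close> by (cases "i = j") auto
      then have "(!) ys ` {..j} \<subseteq> {S \<in> F. v \<notin> S}" using j ys_F by auto
      then have "card ((!) ys ` {..j}) \<le> r v" unfolding r_def using finF by (intro card_mono) auto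
      moreover have "card ((!) ys ` {..j}) = Suc j"
        using that by (subst card_image) (auto intro: inj_on_subset[OF inj_ys])
      ultimately show False using \<open>r v \<le> j\<close> by simp
    qed
  qed
  have is_le: "is ! i \<le> is ! j \<longleftrightarrow> i \<le> j" if "i < length ys" "j < length ys" for i j
    using that assms(4) len sorted_wrt_nth_less[OF assms(5)]
    by (metis leD le_less_linear linorder_neqE_nat nat_less_le)
  have sub: "sublevel N f (is ! j) = ys ! j" if "j < length ys" for j
  proof -
    have "ys ! j \<subseteq> N" using that set_ys assms(2) nth_mem[of j ys] by (auto simp: is_flag_def vertices_def)
    then show ?thesis using that r_less r_le is_le by (auto simp: sublevel_def f_def)
  qed
  have surj: "\<exists>v\<in>N. r v = j" if j: "j < length ys" for j
  proof -
    \<comment> \<open>A point that is new in \<open>ys ! j\<close> has rank exactly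
      \<open>j\<close>. The first entry is treated apart because it has no predecessor and is merely
      nonempty.\<close>
    obtain v where v: "v \<in> ys ! j" "j = 0 \<or> v \<notin> ys ! (j - 1)"
      using nonempty[OF j] ys[of "j - 1" j] j by (cases "j = 0") auto
    have N: "v \<in> N" using v(1) sub[OF j] by (auto simp: sublevel_def)
    have "r v \<le> j" "j = 0 \<or> \<not> r v \<le> j - 1" using N v j r_le[of v j] r_le[of v "j - 1"] by auto
    then have "r v = j" by linarith
    then show ?thesis using N by blast
  qed
  have img: "f ` N = set is"
  proof
    show "f ` N \<subseteq> set is" using r_less assms(4) len by (auto simp: f_def)
    show "set is \<subseteq> f ` N"
    proof
      fix c assume "c \<in> set is"
      then obtain j where j: "j < length ys" "c = is ! j"
        using assms(4) len by (metis in_set_conv_nth)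
      with surj obtain v where "v \<in> N" "r v = j" by blast
      then show "c \<in> f ` N" using j by (auto simp: f_def)
    qed
  qed
  have "sublevel N f ` set is = set ys"
    using sub assms(4) len unfolding set_conv_nth by auto
  \<comment> \<open>Deleting \<open>N\<close> from the sublevel sets therefore leaves precisely
    \<open>F\<close>.\<close>
  moreover have "N \<notin> F" using assms(2) by (auto simp: is_flag_def vertices_def)
  ultimately have "coloring_flag N f = F" unfolding coloring_flag_def img set_ys by simp
  moreover have "sorted_list_of_set (f ` N) = is"
    unfolding img using assms(5)
    by (intro strict_sorted_equal) auto
  moreover have "f \<in> N \<rightarrow>\<^sub>E UNIV" by (simp add: f_def)
  ultimately show ?thesis by blast
qed

lemma length_flag_comp:
  assumes "finite N" "is_flag N F" "N \<noteq> {}"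
  shows "length (flag_comp N F) = Suc (card F)"
  using assms by (simp add: flag_comp_def length_flag_list)

text \<open>The sorted values label the blocks in order, so equal value sets and equal compositions
  force equal fibres.\<close>

lemma coloring_eqI:
  assumes "finite N" "f \<in> N \<rightarrow>\<^sub>E UNIV" "f' \<in> N \<rightarrow>\<^sub>E UNIV"
    and "f ` N = f' ` N" "coloring_comp N f = coloring_comp N f'"
  shows "f = f'"
proof (rule PiE_ext[OF assms(2,3)])
  fix v assume "v \<in> N"
  have "\<forall>i\<in>f ` N. {v \<in> N. f v = i} = {v \<in> N. f' v = i}"
    using assms(1,4,5) by (simp add: coloring_comp_def)
  then have "{u \<in> N. f u = f v} = {u \<in> N. f' u = f v}" using \<open>v \<in> N\<close> by blast
  then have "v \<in> {u \<in> N. f' u = f v}" using \<open>v \<in> N\<close> by blast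
  then show "f v = f' v" by simp
qed

text \<open>The flag determines the composition and the list supplies the labels of its blocks,
  whence injectivity; surjectivity is the construction above.\<close>

lemma bij_betw_coloring_values:
  assumes "finite N" "is_flag N F"
  shows "bij_betw (\<lambda>f. sorted_list_of_set (f ` N)) {f \<in> N \<rightarrow>\<^sub>E UNIV. coloring_flag N f = F}
    {is. length is = length (flag_comp N F) \<and> sorted_wrt (<) is}"
proof (rule bij_betw_imageI)
  show "inj_on (\<lambda>f. sorted_list_of_set (f ` N)) {f \<in> N \<rightarrow>\<^sub>E UNIV. coloring_flag N f = F}"
  proof (rule inj_onI; clarify)
    fix f f' assume "f \<in> N \<rightarrow>\<^sub>E UNIV" "f' \<in> N \<rightarrow>\<^sub>E UNIV" "coloring_flag N f' = coloring_flag N f"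
      "sorted_list_of_set (f ` N) = sorted_list_of_set (f' ` N)"
    with assms(1) show "f = f'"
      by (metis coloring_eqI finite_imageI flag_comp_coloring_flag sorted_list_of_set.set_sorted_key_list_of_set)
  qed
  have "sorted_list_of_set (f ` N) \<in> {is. length is = length (flag_comp N F) \<and> sorted_wrt (<) is}"
    if "coloring_flag N f = F" for f
    using flag_comp_coloring_flag[OF assms(1), of f] that assms(1)
    by (auto simp: coloring_comp_def)
  moreover have "is \<in> (\<lambda>f. sorted_list_of_set (f ` N)) ` {f \<in> N \<rightarrow>\<^sub>E UNIV. coloring_flag N f = F}"
    if "length is = length (flag_comp N F)" "sorted_wrt (<) is" for "is"
  proof (cases "N = {}")
    \<comment> \<open>Over the empty set the flag and the list are both empty, and there is exactly
      one coloring.\<close>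
    case True
    then show ?thesis using that assms(2)
      by (auto simp: flag_comp_def coloring_flag_def is_flag_def vertices_def)
  next
    case False
    then show ?thesis
      using coloring_with_flag_exists[OF assms False _ that(2)] that(1) length_flag_comp[OF assms False]
      by (auto simp: image_iff)
  qed
  ultimately show "(\<lambda>f. sorted_list_of_set (f ` N)) ` {f \<in> N \<rightarrow>\<^sub>E UNIV. coloring_flag N f = F} =
      {is. length is = length (flag_comp N F) \<and> sorted_wrt (<) is}" by auto
qed

section \<open>Monomials and coefficients\<close>

lemma coloring_monomial:
  fixes N :: "'a set" and f :: "'a \<Rightarrow> nat"
  assumes "finite N"
  defines "cs \<equiv> sorted_list_of_set (f ` N)" and "\<alpha> \<equiv> map card (coloring_comp N f)"
  shows "(\<Sum>v\<in>N. Poly_Mapping.single (f v) (1::nat)) =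
    (\<Sum>j<length \<alpha>. Poly_Mapping.single (cs ! j) (\<alpha> ! j))"
proof -
  have const: "(\<Sum>v\<in>A. Poly_Mapping.single i (1::nat)) = Poly_Mapping.single i (card A)"
    for A :: "'a set" and i :: nat
    by (rule poly_mapping_eqI) (simp add: lookup_sum lookup_single when_def card_eq_sum del: sum_constant)
  have cs: "distinct cs" "set cs = f ` N" using assms(1) by (auto simp: cs_def)
  \<comment> \<open>Points are grouped by value: the exponent of a variable is the size of the
    corresponding fibre, that is, of a block.\<close>
  have "(\<Sum>v\<in>N. Poly_Mapping.single (f v) (1::nat)) =
      (\<Sum>i\<in>f ` N. \<Sum>v\<in>{v \<in> N. f v = i}. Poly_Mapping.single (f v) 1)"
    by (rule sum.image_gen[OF assms(1)])
  also have "\<dots> = (\<Sum>i\<in>set cs. Poly_Mapping.single i (card {v \<in> N. f v = i}))"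
    unfolding cs using const assms(1) by (intro sum.cong) auto
  also have "\<dots> = (\<Sum>j<length cs. Poly_Mapping.single (cs ! j) (card {v \<in> N. f v = cs ! j}))"
    by (rule sum.reindex_bij_betw[symmetric]) (rule bij_betw_nth[OF cs(1) refl refl])
  also have "\<dots> = (\<Sum>j<length \<alpha>. Poly_Mapping.single (cs ! j) (\<alpha> ! j))"
    by (intro sum.cong) (auto simp: \<alpha>_def coloring_comp_def cs_def)
  finally show ?thesis .
qed

text \<open>The bijection with increasing lists carries the monomial of a coloring to the matching
  term of the monomial quasisymmetric function, so each coefficient counts the same number of
  objects.\<close>

lemma card_colorings_with_flag:
  assumes "finite N" "is_flag N F"
  shows "int (card {f \<in> N \<rightarrow>\<^sub>E UNIV. coloring_flag N f = F \<and>
      (\<Sum>v\<in>N. Poly_Mapping.single (f v) 1) = m}) =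
    monomial_qsym (descent_comp (card N) (card ` F)) m"
proof -
  let ?A = "{f \<in> N \<rightarrow>\<^sub>E UNIV. coloring_flag N f = F}"
  let ?mon = "\<lambda>f. \<Sum>v\<in>N. Poly_Mapping.single (f v) (1::nat)"
  define \<alpha> where "\<alpha> = map card (flag_comp N F)"
  define mon' where "mon' = (\<lambda>is :: nat list. \<Sum>j<length \<alpha>. Poly_Mapping.single (is ! j) (\<alpha> ! j))"
  let ?B = "{is. length is = length \<alpha> \<and> sorted_wrt (<) (is :: nat list)}"
  have bij: "bij_betw (\<lambda>f. sorted_list_of_set (f ` N)) ?A ?B"
    using bij_betw_coloring_values[OF assms] by (simp add: \<alpha>_def)
  have eq: "mon' (sorted_list_of_set (f ` N)) = ?mon f" if "f \<in> ?A" for f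
    using that coloring_monomial[OF assms(1), of f] flag_comp_coloring_flag[OF assms(1), of f]
    by (auto simp: mon'_def \<alpha>_def)
  have "bij_betw (\<lambda>f. sorted_list_of_set (f ` N)) {f \<in> ?A. ?mon f = m} {is \<in> ?B. mon' is = m}"
    by (rule bij_betw_Collect[OF bij]) (simp only: eq)
  then have "card {f \<in> ?A. ?mon f = m} = card {is \<in> ?B. mon' is = m}"
    by (rule bij_betw_same_card)
  then show ?thesis
    by (simp add: monomial_qsym_def monomial_sum_def descent_comp_flag[OF assms] mon'_def
        conj_ac flip: \<alpha>_def)
qed

text \<open>Exponents are natural numbers and cannot cancel, so every value of such a coloring lies
  in the finite support of \<open>m\<close>. Thus the counts defining coefficients are genuine
  rather than the default 0 of \<open>card\<close> on infinite sets.\<close>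

lemma finite_colorings_with_monomial:
  assumes "finite N"
  shows "finite {f \<in> N \<rightarrow>\<^sub>E UNIV. (\<Sum>v\<in>N. Poly_Mapping.single (f v) (1::nat)) = m}"
proof (rule finite_subset)
  show "finite (N \<rightarrow>\<^sub>E Poly_Mapping.keys m)" using assms by (intro finite_PiE) auto
  have keys: "f v \<in> Poly_Mapping.keys (\<Sum>v\<in>N. Poly_Mapping.single (f v) (1::nat))" if "v \<in> N" for f v
    using assms that by (auto simp: in_keys_iff lookup_sum lookup_single when_def sum_eq_0_iff)
  show "{f \<in> N \<rightarrow>\<^sub>E UNIV. (\<Sum>v\<in>N. Poly_Mapping.single (f v) (1::nat)) = m} \<subseteq>
      N \<rightarrow>\<^sub>E Poly_Mapping.keys m"
  proof
    fix f assume "f \<in> {f \<in> N \<rightarrow>\<^sub>E UNIV. (\<Sum>v\<in>N. Poly_Mapping.single (f v) (1::nat)) = m}"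
    then have f: "f \<in> extensional N" and m: "(\<Sum>v\<in>N. Poly_Mapping.single (f v) (1::nat)) = m"
      by (simp_all add: PiE_def)
    have "f v \<in> Poly_Mapping.keys m" if "v \<in> N" for v using keys[OF that, of f] unfolding m .
    then show "f \<in> N \<rightarrow>\<^sub>E Poly_Mapping.keys m" using f by (simp add: PiE_def Pi_def)
  qed
qed

lemma chromatic_eq_flag_qsym:
  assumes "finite N" "g permutes N"
  shows "chromatic_qsym H \<phi> N h G g = flag_qsym N (coloring_complex H \<phi> N h) G g"
proof
  fix m
  let ?mon = "\<lambda>f. \<Sum>v\<in>N. Poly_Mapping.single (f v) (1::nat)"
  define \<Phi> where "\<Phi> = {F \<in> coloring_complex H \<phi> N h. (\<lambda>S. g ` S) ` F = F}"
  define A where "A = {f \<in> N \<rightarrow>\<^sub>E UNIV. coloring_flag N f \<in> \<Phi> \<and> ?mon f = m}"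
  have flags: "\<And>F. F \<in> \<Phi> \<Longrightarrow> is_flag N F" by (simp add: \<Phi>_def coloring_complex_def)
  have "\<Phi> \<subseteq> Pow (Pow N)" using flags by (auto simp: is_flag_def vertices_def)
  then have fin\<Phi>: "finite \<Phi>" using assms(1) by (meson finite_Pow_iff finite_subset)
  have sub: "coloring_flag N ` A \<subseteq> \<Phi>" by (auto simp: A_def)
  have finA: "finite A"
    unfolding A_def by (rule finite_subset[OF _ finite_colorings_with_monomial[OF assms(1), of m]]) auto
  have "{f \<in> {f \<in> N \<rightarrow>\<^sub>E UNIV. proper_coloring H \<phi> N h f \<and> f \<circ> inv g = f}. ?mon f = m} = A"
    unfolding A_def \<Phi>_def
    by (auto simp: proper_coloring_iff[OF assms(1)] coloring_fixed_iff[OF assms])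
  then have "chromatic_qsym H \<phi> N h G g m = int (card A)"
    by (simp add: chromatic_qsym_def monomial_sum_def)
  \<comment> \<open>The fixed proper colorings with monomial \<open>m\<close> are partitioned by
    their flags, which are the fixed faces.\<close>
  also have "\<dots> = (\<Sum>F\<in>\<Phi>. int (card {f \<in> A. coloring_flag N f = F}))"
    using sum.group[OF finA fin\<Phi> sub, of "\<lambda>_. 1::int"] by simp
  also have "\<dots> = (\<Sum>F\<in>\<Phi>. monomial_qsym (descent_comp (card N) (card ` F)) m)"
  proof (rule sum.cong[OF refl])
    fix F assume F: "F \<in> \<Phi>"
    then have "{f \<in> A. coloring_flag N f = F} = {f \<in> N \<rightarrow>\<^sub>E UNIV. coloring_flag N f = F \<and> ?mon f = m}"
      by (auto simp: A_def)
    then show "int (card {f \<in> A. coloring_flag N f = F}) =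
        monomial_qsym (descent_comp (card N) (card ` F)) m"
      using card_colorings_with_flag[OF assms(1) flags[OF F]] by simp
  qed
  finally show "chromatic_qsym H \<phi> N h G g m = flag_qsym N (coloring_complex H \<phi> N h) G g m"
    by (simp add: flag_qsym_def \<Phi>_def)
qed

text \<open>On vertices, the inverse permutation supplies preimages. On faces, naturality of
  \<open>char_comp\<close> applies with \<open>g\<close> preserving both \<open>N\<close> and
  \<open>h\<close>, so a flag and its image have the same character value.\<close>

lemma struct_aut_complex_aut:
  assumes "linearized_hopf_monoid TYPE('k::field) H" "linearized_character H \<phi>"
    and "finite N" "h \<in> structs H N" "g \<in> struct_aut H N h"
  shows "(`) g \<in> complex_aut N (coloring_complex H \<phi> N h)"
proof -
  have g: "g permutes N" and fix_h: "relabel H N g h = h" using assms(5) by (auto simp: struct_aut_def)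
  have inj: "inj g" and N: "g ` N = N" using g by (auto simp: permutes_inj permutes_image)
  have "bij_betw ((`) g) (vertices N) (vertices N)"
  proof (rule bij_betw_imageI)
    show "inj_on ((`) g) (vertices N)" using inj by (auto intro: inj_onI simp: inj_image_eq_iff)
    have "S \<in> (`) g ` vertices N" if "S \<in> vertices N" for S
    proof
      show "S = g ` inv g ` S" using permutes_inverses[OF g] by (auto simp: image_image)
      show "inv g ` S \<in> vertices N" by (rule permutes_vertices[OF permutes_inv[OF g] that])
    qed
    then show "(`) g ` vertices N = vertices N" 
      using permutes_vertices[OF g] by auto
  qed
  moreover have "card (g ` S) = card S" for S
    using inj by (auto intro: card_image inj_on_subset)
  moreover have "(`) g ` F \<in> coloring_complex H \<phi> N h" if F: "F \<in> coloring_complex H \<phi> N h" for F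
  proof -
    have flag: "is_flag N F" using F by (simp add: coloring_complex_def)
    have "char_comp H \<phi> (g ` N) (map ((`) g) (flag_comp N F)) (relabel H N g h) =
        char_comp H \<phi> N (flag_comp N F) h"
      using inj set_composition_flag_comp[OF assms(3) flag]
      by (intro char_comp_natural[OF assms(1,2,3) _ assms(4)]) (auto intro: inj_on_subset)
    then show ?thesis
      using F flag_image[OF assms(3) flag g] fix_h N by (simp add: coloring_complex_def)
  qed
  ultimately show ?thesis by (auto simp: complex_aut_def)
qed

theorem theorem10:
  fixes H :: "('a, 'h) species_ops"
    and \<phi> :: "'a set \<Rightarrow> 'h \<Rightarrow> nat"
    and N :: "'a set"
    and h :: 'h
    and G :: "('a \<Rightarrow> 'a) set"
  assumes "linearized_hopf_monoid TYPE('k::field) H"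
    and "linearized_character H \<phi>"
    and "balanced_convex H \<phi>"
    and "finite N"
    and "h \<in> structs H N"
    and "G \<subseteq> struct_aut H N h"
  shows "(\<lambda>g S. g ` S) ` G \<subseteq> complex_aut N (coloring_complex H \<phi> N h) \<and>
         (\<forall>g\<in>G. chromatic_qsym H \<phi> N h G g = flag_qsym N (coloring_complex H \<phi> N h) G g)"
proof (intro conjI ballI subsetI)
  fix p assume "p \<in> (\<lambda>g S. g ` S) ` G"
  then show "p \<in> complex_aut N (coloring_complex H \<phi> N h)"
    using struct_aut_complex_aut[OF assms(1,2,4,5)] assms(6) by auto
next
  fix g assume "g \<in> G"
  then have "g permutes N" using assms(6) by (auto simp: struct_aut_def)
  then show "chromatic_qsym H \<phi> N h G g = flag_qsym N (coloring_complex H \<phi> N h) G g"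
    by (rule chromatic_eq_flag_qsym[OF assms(4)])
qed

end
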